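(* Let $p$ be a prime number and $n\ge 1$ an integer. Then: (1) $\mathcal{RP}(\mathbb Z_{p^n})$ is Hamiltonian if and only if $p=2$ and $n\ge 2$; (2) $\mathcal{RP}^*(\mathbb Z_{p^n})$ is non-Hamiltonian.
   Context: For a group $G$ with identity $e$, the reduced power graph $\mathcal{RP}(G)$ is the simple graph with vertex set $G$ in which $u,v$ are adjacent if and only if $\langle v\rangle\subset\langle u\rangle$ or $\langle u\rangle\subset\langle v\rangle$, where $\subset$ means proper inclusion. The proper reduced power graph $\mathcal{RP}^*(G)$ is the subgraph of $\mathcal{RP}(G)$ induced on $G\setminus\{e\}$. A graph is Hamiltonian if it has a spanning cycle (cycles have length at least $3$). *)

theory Defs
  imports
    "HOL-Computational_Algebra.Primes"
    "HOL-Algebra.Elementary_Groups"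
    "Graph_Theory.Graph_Theory"
begin

text \<open>
  A simple graph is represented, as in the Graph Theory library, by a symmetric loop-free
  digraph: an undirected edge between u and v is the pair of arcs (u, v) and (v, u).
\<close>

definition reduced_power_graph :: "('a, 'b) monoid_scheme \<Rightarrow> ('a, 'a \<times> 'a) pre_digraph" where
  "reduced_power_graph G = with_proj
     \<lparr> pverts = carrier G,
       parcs = {(u, v). u \<in> carrier G \<and> v \<in> carrier G \<and>
         (generate G {v} \<subset> generate G {u} \<or> generate G {u} \<subset> generate G {v})} \<rparr>"

definition proper_reduced_power_graph ::
    "('a, 'b) monoid_scheme \<Rightarrow> ('a, 'a \<times> 'a) pre_digraph" where
  "proper_reduced_power_graph G = reduced_power_graph G \<restriction> (carrier G - {\<one>\<^bsub>G\<^esub>})"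

text \<open>
  The library's cycles are non-empty lists of arcs forming a closed walk without repeated
  vertices; this includes the walk u, v, u along a single undirected edge, so the bound on
  the length has to be added. On a closed walk every vertex is the tail of some arc, hence
  the last conjunct says that the cycle is spanning.
\<close>

definition hamiltonian :: "('a, 'b) pre_digraph \<Rightarrow> bool" where
  "hamiltonian H \<longleftrightarrow>
     (\<exists>c. pre_digraph.cycle H c \<and> length c \<ge> 3 \<and> tail H ` set c = verts H)"

lemma graph_reduced_power_graph:
  assumes "finite (carrier G)"
  shows "graph (reduced_power_graph G)"
proof -
  let ?E = "{(u, v). u \<in> carrier G \<and> v \<in> carrier G \<and>
    (generate G {v} \<subset> generate G {u} \<or> generate G {u} \<subset> generate G {v})}"
  have "?E \<subseteq> carrier G \<times> carrier G" by auto
  then have "finite ?E" using assms by (meson finite_SigmaI finite_subset)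
  then have "pair_graph \<lparr> pverts = carrier G, parcs = ?E \<rparr>"
    using assms by unfold_locales (auto simp: symmetric_def intro!: symI)
  then show ?thesis
    unfolding reduced_power_graph_def by (rule pair_graph.pair_graphD_graph)
qed

lemma induced_subgraph_proper_reduced_power_graph:
  "induced_subgraph (proper_reduced_power_graph G) (reduced_power_graph G)"
proof -
  have "wf_digraph (reduced_power_graph G)"
    unfolding reduced_power_graph_def by unfold_locales auto
  then show ?thesis
    unfolding proper_reduced_power_graph_def
    by (rule wf_digraph.induced_induce) (auto simp: reduced_power_graph_def)
qed

end

theory Submission
  imports Defs
begin

text \<open>
  The generators of \<open>\<int>/p\<^sup>n\<close> are the residues prime to \<open>p\<close>, and there are \<open>p\<^sup>n - p\<^sup>n\<^sup>-\<^sup>1\<close> of them. They all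
  generate the whole group, so they form an independent set of the reduced power graph and of
  its proper part. On a spanning cycle the successor map sends an independent set injectively
  into its complement, so in a Hamiltonian graph an independent set contains at most half of the
  vertices (\<open>hamiltonian_independent_set_bound\<close>). For the reduced power graph this reads
  \<open>2 (p\<^sup>n - p\<^sup>n\<^sup>-\<^sup>1) \<le> p\<^sup>n\<close>, which forces \<open>p = 2\<close>; with one vertex less it reads
  \<open>2 (p\<^sup>n - p\<^sup>n\<^sup>-\<^sup>1) \<le> p\<^sup>n - 1\<close>, which is impossible. For \<open>p = 2\<close> and \<open>n = 1\<close> there are too few vertices
  for a cycle.

  Conversely, a generator is adjacent to every non-generator. For \<open>p = 2\<close> this says that
  residues of different parity are adjacent, so \<open>0, 1, \<dots>, 2\<^sup>n - 1, 0\<close> is a closed walk through all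
  vertices, and it is a cycle of length at least three once \<open>n \<ge> 2\<close>.
\<close>

section \<open>Hamiltonian cycles\<close>

text \<open>The heads of the arcs of a cycle are pairwise distinct: they are the vertices listed along the
  walk after its starting point, and the definition of a cycle asks precisely that these do not
  repeat.\<close>

lemma (in wf_digraph) hamiltonian_cycle_arcs:
  assumes "hamiltonian G"
  obtains c where "3 \<le> length c" "set c \<subseteq> arcs G" "tail G ` set c = verts G"
    "distinct (map (head G) c)"
proof -
  obtain c u where c: "c \<noteq> []" "3 \<le> length c" "tail G ` set c = verts G"
    and walk: "awalk u c u" and dist: "distinct (tl (awalk_verts u c))"
    using assms unfolding hamiltonian_def cycle_def by blast
  have "set c \<subseteq> arcs G" "cas u c u"
    using walk by auto
  with c dist show ?thesis using that by (simp add: awalk_verts_conv')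
qed

lemma hamiltonian_card_verts_ge_3:
  assumes "wf_digraph H" "finite (verts H)" "hamiltonian H"
  shows "3 \<le> card (verts H)"
proof -
  interpret wf_digraph H by fact
  obtain c where c: "3 \<le> length c" "set c \<subseteq> arcs H" "distinct (map (head H) c)"
    using hamiltonian_cycle_arcs[OF assms(3)] by metis
  have "length c = card (head H ` set c)"
    using distinct_card[OF c(3)] by simp
  also have "\<dots> \<le> card (verts H)"
    using assms(2) c(2) by (intro card_mono) auto
  finally show ?thesis using c(1) by simp
qed

lemma hamiltonian_independent_set_bound:
  assumes "wf_digraph H" "finite (verts H)" "hamiltonian H" "I \<subseteq> verts H"
    and indep: "\<And>e. e \<in> arcs H \<Longrightarrow> tail H e \<in> I \<Longrightarrow> head H e \<notin> I"
  shows "2 * card I \<le> card (verts H)"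
proof -
  interpret wf_digraph H by fact
  obtain c where c: "set c \<subseteq> arcs H" "tail H ` set c = verts H" "distinct (map (head H) c)"
    using hamiltonian_cycle_arcs[OF assms(3)] by metis
  then have inj: "inj_on (head H) (set c)"
    by (simp add: distinct_map)
  \<comment> \<open>Each vertex of \<open>I\<close> is left by some cycle arc, whose head is then outside \<open>I\<close>.\<close>
  define A where "A = {e \<in> set c. tail H e \<in> I}"
  have "finite A" by (simp add: A_def)
  have "I = tail H ` A" using c(2) assms(4) by (auto simp: A_def)
  then have "card I \<le> card A" using \<open>finite A\<close> by (simp add: card_image_le)
  also have "card A = card (head H ` A)"
    by (rule card_image[symmetric], rule inj_on_subset[OF inj]) (auto simp: A_def)
  also have "head H ` A \<subseteq> verts H - I"
    using c(1) indep by (auto simp: A_def)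
  then have "card (head H ` A) \<le> card (verts H - I)"
    using assms(2) by (intro card_mono) auto
  also have "card (verts H - I) = card (verts H) - card I"
    using assms(2,4) by (simp add: card_Diff_subset finite_subset)
  finally have "card I \<le> card (verts H) - card I" .
  moreover have "card I \<le> card (verts H)"
    using assms(2,4) by (simp add: card_mono)
  ultimately show ?thesis by simp
qed

lemma hamiltonianI_closed_sequence:
  assumes "wf_digraph H" "3 \<le> N" "f N = f 0" "inj_on f {..<N}" "f ` {..<N} = verts H"
    and arc: "\<And>i. i < N \<Longrightarrow> a i \<in> arcs H \<and> tail H (a i) = f i \<and> head H (a i) = f (Suc i)"
  shows "hamiltonian H"
proof -
  interpret wf_digraph H by fact
  define c where "c = map a [0..<N]"
  have "c \<noteq> []" using assms(2) by (simp add: c_def)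
  have "f 0 \<in> verts H" using assms(2,5) by (metis imageI lessThan_iff less_le_trans zero_less_numeral)
  have "m \<le> N \<Longrightarrow> awalk (f 0) (map a [0..<m]) (f m)" for m
  proof (induction m)
    case 0
    show ?case using \<open>f 0 \<in> verts H\<close> by (simp add: awalk_Nil_iff)
  next
    case (Suc m)
    then have "awalk (f m) [a m] (f (Suc m))"
      using arc[of m] arc_implies_awalk[of "a m"] by simp
    then show ?case using Suc awalk_appendI by fastforce
  qed
  then have walk: "awalk (f 0) c (f 0)"
    using assms(3) by (metis c_def order_refl)
  have tails: "map (tail H) c = map f [0..<N]"
    using arc by (simp add: c_def)
  \<comment> \<open>The heads are \<open>f 1, \<dots>, f N\<close>, which is a rotation of \<open>f 0, \<dots>, f (N - 1)\<close>.\<close>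
  have "map (head H) c = map f [Suc 0..<Suc N]"
    using arc by (simp add: c_def map_Suc_upt[symmetric] del: upt_Suc)
  also have "\<dots> = map f ([Suc 0..<N] @ [N])"
    using assms(2) by simp
  also have "mset \<dots> = mset (map f (0 # [Suc 0..<N]))"
    using assms(3) by simp
  also have "0 # [Suc 0..<N] = [0..<N]"
    using assms(2) by (simp add: upt_conv_Cons)
  finally have "distinct (map (head H) c) \<longleftrightarrow> distinct (map f [0..<N])"
    by (rule mset_eq_imp_distinct_iff)
  then have "distinct (map (head H) c)"
    using assms(4) by (simp add: distinct_map atLeast0LessThan)
  then have "cycle c"
    unfolding cycle_def using walk \<open>c \<noteq> []\<close> awalk_verts_conv' by (metis awalkE' list.sel(3))
  moreover have "tail H ` set c = verts H"
    using tails assms(5) by (metis atLeast0LessThan list.set_map set_upt)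
  moreover have "length c = N" by (simp add: c_def)
  ultimately show ?thesis
    unfolding hamiltonian_def using assms(2) by blast
qed

section \<open>The reduced power graph of a cyclic group of prime power order\<close>

lemma verts_reduced_power_graph [simp]: "verts (reduced_power_graph G) = carrier G"
  by (simp add: reduced_power_graph_def)

lemma arcs_reduced_power_graph [simp]:
  "arcs (reduced_power_graph G) = {(u, v). u \<in> carrier G \<and> v \<in> carrier G \<and>
     (generate G {v} \<subset> generate G {u} \<or> generate G {u} \<subset> generate G {v})}"
  by (simp add: reduced_power_graph_def)

lemma tail_reduced_power_graph [simp]: "tail (reduced_power_graph G) = fst"
  by (simp add: reduced_power_graph_def)

lemma head_reduced_power_graph [simp]: "head (reduced_power_graph G) = snd"
  by (simp add: reduced_power_graph_def)

lemma wf_digraph_reduced_power_graph: "wf_digraph (reduced_power_graph G)"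
  by unfold_locales auto

lemma generate_integer_mod_group:
  assumes "x \<in> carrier (integer_mod_group m)"
  shows "generate (integer_mod_group m) {x} = {k * x mod int m | k. True}"
  using group.generate_pow[OF group_integer_mod_group assms]
  by (simp add: int_pow_integer_mod_group)

lemma generate_integer_mod_group_coprime:
  assumes "0 < m" "x \<in> carrier (integer_mod_group m)" "coprime x (int m)"
  shows "generate (integer_mod_group m) {x} = carrier (integer_mod_group m)"
proof
  show "generate (integer_mod_group m) {x} \<subseteq> carrier (integer_mod_group m)"
    using group.generate_incl[OF group_integer_mod_group] assms(2) by blast
  show "carrier (integer_mod_group m) \<subseteq> generate (integer_mod_group m) {x}"
  proof
    fix y assume y: "y \<in> carrier (integer_mod_group m)"
    obtain b c where bc: "b * x + c * int m = 1"
      using bezout_int[of x "int m"] assms(3) by auto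
    have "y * b * x = y * (b * x + c * int m) - y * c * int m"
      by (simp add: algebra_simps)
    then have "y * b * x = y + (- (y * c)) * int m"
      by (simp add: bc)
    then have "y * b * x mod int m = y"
      using y assms(1) by (simp only: mod_mult_self1) (simp add: carrier_integer_mod_group)
    then show "y \<in> generate (integer_mod_group m) {x}"
      unfolding generate_integer_mod_group[OF assms(2)] by (metis (mono_tags, lifting) mem_Collect_eq)
  qed
qed

lemma generate_integer_mod_group_common_divisor:
  assumes "x \<in> carrier (integer_mod_group m)" "d dvd x" "d dvd int m"
    and "y \<in> generate (integer_mod_group m) {x}"
  shows "d dvd y"
  using assms by (auto simp: generate_integer_mod_group dvd_mod)

text \<open>The residues modulo \<open>p\<^sup>n\<close> that are prime to \<open>p\<close>; for \<open>n \<ge> 1\<close> these are the generators.\<close>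

definition prime_power_units :: "nat \<Rightarrow> nat \<Rightarrow> int set" where
  "prime_power_units p n = {u \<in> carrier (integer_mod_group (p ^ n)). \<not> int p dvd u}"

lemma generate_prime_power_units:
  assumes "prime p" "u \<in> prime_power_units p n"
  shows "generate (integer_mod_group (p ^ n)) {u} = carrier (integer_mod_group (p ^ n))"
proof (rule generate_integer_mod_group_coprime)
  show "0 < p ^ n" using assms(1) by (simp add: prime_gt_0_nat)
  show "u \<in> carrier (integer_mod_group (p ^ n))"
    using assms(2) by (simp add: prime_power_units_def)
  have "coprime (int p) u"
    using assms by (intro prime_imp_coprime) (auto simp: prime_power_units_def)
  then show "coprime u (int (p ^ n))"
    by (simp add: coprime_commute)
qed

lemma generate_not_prime_power_units:
  assumes "prime p" "n \<ge> 1" "v \<in> carrier (integer_mod_group (p ^ n))" "v \<notin> prime_power_units p n"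
  shows "generate (integer_mod_group (p ^ n)) {v} \<subset> carrier (integer_mod_group (p ^ n))"
proof -
  have "p ^ n \<noteq> 1" using assms(1,2) by (auto simp: prime_gt_1_nat)
  then have "1 \<in> carrier (integer_mod_group (p ^ n))" by simp
  moreover have "1 \<notin> generate (integer_mod_group (p ^ n)) {v}"
  proof
    assume "1 \<in> generate (integer_mod_group (p ^ n)) {v}"
    moreover have "int p dvd v"
      using assms(3,4) by (simp add: prime_power_units_def)
    moreover have "int p dvd int (p ^ n)" using assms(2) by simp
    ultimately have "int p dvd 1"
      using generate_integer_mod_group_common_divisor assms(3) by blast
    then show False using assms(1) by simp
  qed
  ultimately show ?thesis
    using group.generate_incl[OF group_integer_mod_group, of "{v}" "p ^ n"] assms(3) by blast
qed

lemma card_prime_power_units: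
  assumes "prime p"
  shows "card (prime_power_units p (Suc k)) = p ^ Suc k - p ^ k"
proof -
  have p: "0 < p" using assms by (rule prime_gt_0_nat)
  let ?C = "{0..<int (p ^ Suc k)}" and ?M = "(\<lambda>j. int p * j) ` {0..<int (p ^ k)}"
  have "prime_power_units p (Suc k) = ?C - ?M"
    using p by (auto simp: prime_power_units_def carrier_integer_mod_group image_iff
        zero_le_mult_iff elim!: dvdE)
  moreover have "?M \<subseteq> ?C" using p by auto
  moreover have "card ?M = p ^ k"
    using p by (subst card_image) (auto simp: inj_on_def nat_power_eq)
  ultimately show ?thesis by (simp add: card_Diff_subset nat_mult_distrib nat_power_eq)
qed

lemma prime_power_units_independent:
  assumes "prime p" "e \<in> arcs (reduced_power_graph (integer_mod_group (p ^ n)))"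
    and "fst e \<in> prime_power_units p n"
  shows "snd e \<notin> prime_power_units p n"
  using assms generate_prime_power_units by fastforce

section \<open>Hamiltonicity for prime power order\<close>

lemma not_hamiltonian_proper_reduced_power_graph:
  assumes "prime p" "n \<ge> 1"
  shows "\<not> hamiltonian (proper_reduced_power_graph (integer_mod_group (p ^ n)))"
proof
  let ?G = "integer_mod_group (p ^ n)" and ?U = "prime_power_units p n"
  let ?H = "proper_reduced_power_graph ?G"
  assume "hamiltonian ?H"
  have p: "2 \<le> p" using assms(1) by (rule prime_ge_2_nat)
  obtain k where n: "n = Suc k" using assms(2) by (cases n) auto
  have verts: "verts ?H = {0<..<int (p ^ n)}"
    using p by (auto simp: proper_reduced_power_graph_def carrier_integer_mod_group)
  have card: "card (verts ?H) = p * p ^ k - 1"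
    unfolding verts by (simp add: n nat_diff_distrib' nat_mult_distrib nat_power_eq)
  have "2 * card ?U \<le> card (verts ?H)"
  proof (rule hamiltonian_independent_set_bound)
    show "wf_digraph ?H"
      unfolding proper_reduced_power_graph_def
      by (intro wf_digraph.wellformed_induce_subgraph wf_digraph_reduced_power_graph)
    have "0 < u" if "u \<in> ?U" for u
      using that p by (cases "u = 0") (auto simp: prime_power_units_def carrier_integer_mod_group)
    then show "?U \<subseteq> verts ?H"
      using p by (auto simp: verts prime_power_units_def carrier_integer_mod_group)
    show "head ?H e \<notin> ?U" if "e \<in> arcs ?H" "tail ?H e \<in> ?U" for e
      using that prime_power_units_independent[OF assms(1), of e n]
      by (simp add: proper_reduced_power_graph_def)
  qed (use \<open>hamiltonian ?H\<close> in \<open>simp_all add: verts\<close>)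
  then have "2 * (p * p ^ k - p ^ k) \<le> p * p ^ k - 1"
    unfolding card using assms(1) by (simp add: n card_prime_power_units)
  moreover have "2 * p ^ k \<le> p * p ^ k" using p by simp
  moreover have "0 < p ^ k" using p by simp
  ultimately show False by linarith
qed

lemma hamiltonian_reduced_power_graph_imp:
  assumes "prime p" "n \<ge> 1" "hamiltonian (reduced_power_graph (integer_mod_group (p ^ n)))"
  shows "p = 2 \<and> n \<ge> 2"
proof -
  let ?G = "integer_mod_group (p ^ n)" and ?U = "prime_power_units p n"
  let ?H = "reduced_power_graph ?G"
  have p: "2 \<le> p" using assms(1) by (rule prime_ge_2_nat)
  obtain k where n: "n = Suc k" using assms(2) by (cases n) auto
  have verts: "verts ?H = {0..<int (p ^ n)}"
    using p by (auto simp: carrier_integer_mod_group)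
  have fin: "finite (verts ?H)" unfolding verts by simp
  have card: "card (verts ?H) = p * p ^ k"
    unfolding verts by (simp add: n nat_diff_distrib' nat_mult_distrib nat_power_eq)
  have "2 * card ?U \<le> card (verts ?H)"
  proof (rule hamiltonian_independent_set_bound[OF wf_digraph_reduced_power_graph _ assms(3)])
    show "finite (verts ?H)" by (rule fin)
    show "?U \<subseteq> verts ?H" by (auto simp: prime_power_units_def)
    show "head ?H e \<notin> ?U" if "e \<in> arcs ?H" "tail ?H e \<in> ?U" for e
      using that prime_power_units_independent[OF assms(1), of e n] by simp
  qed
  then have bound: "2 * (p * p ^ k - p ^ k) \<le> p * p ^ k"
    unfolding card using assms(1) by (simp add: n card_prime_power_units)
  have "p = 2"
  proof (rule ccontr)
    assume "p \<noteq> 2"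
    then have "3 \<le> p" using p by simp
    then have "3 * p ^ k \<le> p * p ^ k" by simp
    moreover have "0 < p ^ k" using p by simp
    ultimately show False using bound by linarith
  qed
  moreover have "3 \<le> p ^ n"
    using hamiltonian_card_verts_ge_3[OF wf_digraph_reduced_power_graph fin assms(3)]
    unfolding card by (simp add: n)
  ultimately have "n \<noteq> 1" by auto
  with \<open>p = 2\<close> show ?thesis using assms(2) by simp
qed

lemma hamiltonian_reduced_power_graph_two_power:
  assumes "n \<ge> 2"
  shows "hamiltonian (reduced_power_graph (integer_mod_group (2 ^ n)))"
proof -
  let ?G = "integer_mod_group (2 ^ n)" and ?U = "prime_power_units 2 n"
  let ?H = "reduced_power_graph ?G"
  define f where "f i = int (i mod 2 ^ n)" for i
  have n: "n \<ge> 1" "even ((2::nat) ^ n)" using assms by auto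
  have carrier: "f i \<in> carrier ?G" for i
    by (simp add: f_def carrier_integer_mod_group)
  have unit: "f i \<in> ?U \<longleftrightarrow> odd i" for i
    using carrier[of i] n by (simp add: prime_power_units_def f_def dvd_mod_iff)
  have less: "generate ?G {f j} \<subset> generate ?G {f i}" if "odd i" "even j" for i j
    using that n generate_prime_power_units[of 2 "f i" n]
      generate_not_prime_power_units[of 2 n "f j"] carrier unit by simp
  show ?thesis
  proof (rule hamiltonianI_closed_sequence[OF wf_digraph_reduced_power_graph,
        where N = "2 ^ n" and f = f and a = "\<lambda>i. (f i, f (Suc i))"])
    have "(2::nat) ^ 2 \<le> 2 ^ n" using assms by (intro power_increasing) auto
    then show "(3::nat) \<le> 2 ^ n" by simp
    show "f (2 ^ n) = f 0" by (simp add: f_def)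
    show "inj_on f {..<2 ^ n}" by (auto simp: inj_on_def f_def)
    have "f ` {..<2 ^ n} = int ` {0..<2 ^ n}"
      by (rule image_cong) (auto simp: f_def)
    then show "f ` {..<2 ^ n} = verts ?H"
      by (simp add: image_int_atLeastLessThan carrier_integer_mod_group)
    show "(f i, f (Suc i)) \<in> arcs ?H \<and> tail ?H (f i, f (Suc i)) = f i
        \<and> head ?H (f i, f (Suc i)) = f (Suc i)" for i
      using carrier less[of i "Suc i"] less[of "Suc i" i] by (cases "even i") auto
  qed
qed

theorem proposition5p3:
  fixes p n :: nat
  assumes "prime p" and "n \<ge> 1"
  shows "(hamiltonian (reduced_power_graph (integer_mod_group (p ^ n))) \<longleftrightarrow> p = 2 \<and> n \<ge> 2)
    \<and> \<not> hamiltonian (proper_reduced_power_graph (integer_mod_group (p ^ n)))"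
  using hamiltonian_reduced_power_graph_imp[OF assms] hamiltonian_reduced_power_graph_two_power
    not_hamiltonian_proper_reduced_power_graph[OF assms]
  by blast

end
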